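(* Consider the two-user single-input-single-output Gaussian interference channel $y_1=h_{11}x_1+h_{12}x_2+n_1$, $y_2=h_{21}x_1+h_{22}x_2+n_2$, where $h_{rt}\in\mathbb{C}$, the noises $n_1,n_2$ are zero-mean circularly symmetric complex Gaussian with variance $\sigma^2>0$, and $x_1,x_2$ are independent zero-mean complex Gaussian (possibly improper) random variables, independent of the noises, with covariances $C_{x_r}=\mathbb{E}(x_rx_r^* )$ and pseudo-covariances $\widetilde{C}_{x_r}=\mathbb{E}(x_rx_r)$, so that $|\widetilde{C}_{x_r}|\le C_{x_r}$ for $r=1,2$. For $r\in\{1,2\}$ let $\overline{r}$ denote the other index, and put $$C_{y_r}=|h_{r1}|^2C_{x_1}+|h_{r2}|^2C_{x_2}+\sigma^2,\qquad \widetilde{C}_{y_r}=h_{r1}^2\widetilde{C}_{x_1}+h_{r2}^2\widetilde{C}_{x_2},$$ $$C_{s_r}=|h_{r\overline{r}}|^2C_{x_{\overline{r}}}+\sigma^2,\qquad \widetilde{C}_{s_r}=h_{r\overline{r}}^2\widetilde{C}_{x_{\overline{r}}}.$$ Then the rate $R_r=I(x_r;y_r)$ achievable at receiver $r$ when interference is treated as additive Gaussian noise is $$R_r=\log\Big(1+\frac{|h_{rr}|^2C_{x_r}}{\sigma^2+|h_{r\overline{r}}|^2C_{x_{\overline{r}}}}\Big)+\frac12\log\frac{1-C_{y_r}^{-2}|\widetilde{C}_{y_r}|^2}{1-C_{s_r}^{-2}|\widetilde{C}_{s_r}|^2}.$$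
   Context: A zero-mean complex random variable $z$ has covariance $C_z=\mathbb{E}(zz^* )$ and pseudo-covariance $\widetilde{C}_z=\mathbb{E}(zz)$; it is proper if $\widetilde{C}_z=0$ and improper otherwise. A complex Gaussian random variable is one whose real and imaginary parts are jointly Gaussian. The differential entropy of a complex random variable is that of the pair (real part, imaginary part), and $I(\cdot;\cdot)$ denotes mutual information. The rate achievable at receiver $r$ with interference treated as additive Gaussian noise (and perfect channel knowledge at all terminals) is defined to be $I(x_r;y_r)$. Logarithms are natural. The signal $s_r=h_{r\overline{r}}x_{\overline{r}}+n_r$ is the interference-plus-noise at receiver $r$. *)

theory Defs
  imports "HOL-Probability.Probability"
begin

(* Gaussian in the wide sense: point masses (zero variance) are included, since maximally
   improper signals have a degenerate real covariance matrix. *)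
definition gaussian_rv :: "'a measure \<Rightarrow> ('a \<Rightarrow> real) \<Rightarrow> bool" where
  "gaussian_rv M X \<longleftrightarrow>
     (\<exists>\<mu>. X \<in> borel_measurable M \<and> distr M borel X = return borel \<mu>) \<or>
     (\<exists>\<mu> \<sigma>. \<sigma> > 0 \<and> distributed M lborel X (\<lambda>t. ennreal (normal_density \<mu> \<sigma> t)))"

definition jointly_gaussian :: "'a measure \<Rightarrow> ('a \<Rightarrow> real) \<Rightarrow> ('a \<Rightarrow> real) \<Rightarrow> bool" where
  "jointly_gaussian M X Y \<longleftrightarrow> (\<forall>a b. gaussian_rv M (\<lambda>\<omega>. a * X \<omega> + b * Y \<omega>))"

definition complex_gaussian :: "'a measure \<Rightarrow> ('a \<Rightarrow> complex) \<Rightarrow> bool" where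
  "complex_gaussian M z \<longleftrightarrow> jointly_gaussian M (\<lambda>\<omega>. Re (z \<omega>)) (\<lambda>\<omega>. Im (z \<omega>))"

definition zero_mean :: "'a measure \<Rightarrow> ('a \<Rightarrow> complex) \<Rightarrow> bool" where
  "zero_mean M z \<longleftrightarrow> integrable M z \<and> (\<integral>\<omega>. z \<omega> \<partial>M) = 0"

definition circularly_symmetric :: "'a measure \<Rightarrow> ('a \<Rightarrow> complex) \<Rightarrow> bool" where
  "circularly_symmetric M z \<longleftrightarrow> (\<forall>\<theta>. distr M borel (\<lambda>\<omega>. cis \<theta> * z \<omega>) = distr M borel z)"

(* E(z z^* ) is real; Re only moves it to type real. *)
definition covariance :: "'a measure \<Rightarrow> ('a \<Rightarrow> complex) \<Rightarrow> real" where
  "covariance M z = Re (\<integral>\<omega>. z \<omega> * cnj (z \<omega>) \<partial>M)"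

definition pseudo_covariance :: "'a measure \<Rightarrow> ('a \<Rightarrow> complex) \<Rightarrow> complex" where
  "pseudo_covariance M z = (\<integral>\<omega>. z \<omega> * z \<omega> \<partial>M)"

definition other_user :: "nat \<Rightarrow> nat" where
  "other_user r = (if r = 1 then 2 else 1)"

definition channel_output ::
  "(nat \<Rightarrow> nat \<Rightarrow> complex) \<Rightarrow> (nat \<Rightarrow> 'a \<Rightarrow> complex) \<Rightarrow> (nat \<Rightarrow> 'a \<Rightarrow> complex) \<Rightarrow> nat \<Rightarrow> 'a \<Rightarrow> complex"
  where "channel_output h x n r \<omega> = h r 1 * x 1 \<omega> + h r 2 * x 2 \<omega> + n r \<omega>"

(* In nats; a complex variable is identified with the pair (Re, Im) through the Borel
   structure on the complex numbers. *)
definition achievable_rate :: "'a measure \<Rightarrow> ('a \<Rightarrow> complex) \<Rightarrow> ('a \<Rightarrow> complex) \<Rightarrow> real" where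
  "achievable_rate M x y = prob_space.mutual_information M (exp 1) borel borel x y"

end

(* With s the interference plus noise, y = h x + s with x independent of s, so the joint law of
   (x, y) has density g (y - h x) / p y with respect to the product of its marginals, where g and p
   are the densities of s and y; hence I(x; y) = E ln g(s) - E ln p(y). Thus x itself may be
   degenerate (maximally improper), while s and y have densities thanks to the noise. For a centered
   complex Gaussian, E ln of its density is -1 - ln pi - ln (C^2 - |P|^2) / 2, where C is the
   covariance and P the pseudo-covariance.

   Characteristic functions are available only in dimension one. The density of a planar Gaussian
   is obtained by writing Im z = k Re z + W with W uncorrelated with Re z; independence of Re z and W
   follows from the factorisation of the joint characteristic function by using one-dimensional
   uniqueness twice, each time for a tilted measure. *)
theory Submission
  imports Defs
begin

section \<open>Characteristic functions on the real line and independence\<close>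

lemma borel_measurable_cis [measurable]: "cis \<in> borel_measurable borel"
  by (intro borel_measurable_continuous_onI continuous_intros)

context prob_space
begin

lemma integrable_cis [intro]:
  fixes Z :: "'a \<Rightarrow> real"
  assumes [measurable]: "random_variable borel Z"
  shows "integrable M (\<lambda>\<omega>. cis (Z \<omega>))"
  by (rule integrable_const_bound[of _ 1]) auto

(* Uniqueness of characteristic functions, applied to the law of Y under M tilted by a positive
   affine function of f. *)
lemma expectation_indicator_eq_of_characteristic:
  fixes f Y :: "'a \<Rightarrow> real"
  assumes f [measurable]: "random_variable borel f" and Y [measurable]: "random_variable borel Y"
    and bound: "\<And>\<omega>. \<bar>f \<omega>\<bar> \<le> K"
    and char: "\<And>s. expectation (\<lambda>\<omega>. f \<omega> *\<^sub>R cis (s * Y \<omega>)) = expectation f *\<^sub>R expectation (\<lambda>\<omega>. cis (s * Y \<omega>))"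
    and B [measurable]: "B \<in> sets borel"
  shows "expectation (\<lambda>\<omega>. f \<omega> * indicator B (Y \<omega>)) = expectation f * prob (Y -` B \<inter> space M)"
proof -
  \<comment> \<open>Since \<open>f\<close> is bounded by \<open>K\<close>, the shift makes
    \<open>g\<close> at least 1, so \<open>g / m\<close> is a probability density. The claim is
    affine in \<open>f\<close> and holds trivially for constants, so it can be recovered from
    \<open>g\<close> at the end.\<close>
  define g where "g \<omega> = f \<omega> + K + 1" for \<omega>
  have [measurable]: "random_variable borel g" by (simp add: g_def[abs_def])
  have g_ge: "g \<omega> \<ge> 1" for \<omega> using bound[of \<omega>] by (simp add: g_def abs_le_iff)
  have int_f: "integrable M f" by (rule integrable_const_bound[of _ K]) (use bound in auto)
  have int_g: "integrable M g" by (simp add: g_def[abs_def] int_f)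
  define m where "m = expectation g"
  have m_eq: "m = expectation f + K + 1" by (simp add: m_def g_def[abs_def] int_f prob_space)
  have "1 \<le> m" using integral_mono[of M "\<lambda>_. 1" g] int_g g_ge by (simp add: m_def prob_space)
  hence m: "m > 0" by simp
  define N where "N = density M (\<lambda>\<omega>. ennreal (g \<omega> / m))"
  have sets_N [simp, measurable_cong]: "sets N = sets M" by (simp add: N_def)
  have g_nn: "AE \<omega> in M. 0 \<le> g \<omega> / m" using g_ge m by (auto intro!: AE_I2 divide_nonneg_pos intro: order_trans[OF zero_le_one])
  have N: "prob_space N"
  proof
    have "emeasure N (space N) = (\<integral>\<^sup>+ \<omega>. ennreal (g \<omega> / m) \<partial>M)"
      by (simp add: N_def emeasure_density cong: nn_integral_cong)
    also have "\<dots> = ennreal (\<integral>\<omega>. g \<omega> / m \<partial>M)"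
      by (rule nn_integral_eq_integral) (use int_g g_nn in auto)
    also have "\<dots> = 1" using m by (simp add: m_def)
    finally show "emeasure N (space N) = 1" .
  qed
  interpret N: prob_space N by fact
  have int_cis: "integrable M (\<lambda>\<omega>. cis (s * Y \<omega>))" for s
    by auto
  have int_fcis: "integrable M (\<lambda>\<omega>. f \<omega> *\<^sub>R cis (s * Y \<omega>))" for s
    by (rule integrable_const_bound[of _ K]) (use bound in auto)
  \<comment> \<open>By \<open>char\<close>, weighting with \<open>g\<close> multiplies the
    characteristic function of \<open>Y\<close> by the constant \<open>m\<close>, which the
    normalisation divides out again.\<close>
  have "distr N borel Y = distr M borel Y"
  proof (rule Levy_uniqueness)
    show "real_distribution (distr N borel Y)" by (rule N.real_distribution_distr) simp
    show "real_distribution (distr M borel Y)" by (rule real_distribution_distr) simp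
    show "Characteristic_Functions.char (distr N borel Y) = Characteristic_Functions.char (distr M borel Y)"
    proof
      fix s
      have "Characteristic_Functions.char (distr N borel Y) s = (\<integral>\<omega>. cis (s * Y \<omega>) \<partial>N)"
        unfolding char_def by (subst integral_distr) (auto simp: cis_conv_exp)
      also have "\<dots> = (\<integral>\<omega>. (g \<omega> / m) *\<^sub>R cis (s * Y \<omega>) \<partial>M)"
        unfolding N_def by (rule integral_density) (use g_nn in auto)
      also have "\<dots> = (\<integral>\<omega>. (1 / m) *\<^sub>R (f \<omega> *\<^sub>R cis (s * Y \<omega>) + (K + 1) *\<^sub>R cis (s * Y \<omega>)) \<partial>M)"
        by (rule Bochner_Integration.integral_cong)
          (auto simp: g_def scaleR_conv_of_real add_divide_distrib ring_distribs)
      also have "\<dots> = (1 / m) *\<^sub>R (expectation (\<lambda>\<omega>. f \<omega> *\<^sub>R cis (s * Y \<omega>)) + (K + 1) *\<^sub>R expectation (\<lambda>\<omega>. cis (s * Y \<omega>)))"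
        by (simp only: integral_scaleR_right Bochner_Integration.integral_add int_fcis int_cis integrable_scaleR_right)
      also have "\<dots> = (1 / m) *\<^sub>R (m *\<^sub>R expectation (\<lambda>\<omega>. cis (s * Y \<omega>)))"
        by (simp only: char m_eq scaleR_add_left add.assoc)
      also have "\<dots> = expectation (\<lambda>\<omega>. cis (s * Y \<omega>))" using m by simp
      also have "\<dots> = Characteristic_Functions.char (distr M borel Y) s"
        unfolding char_def by (subst integral_distr) (auto simp: cis_conv_exp)
      finally show "Characteristic_Functions.char (distr N borel Y) s = Characteristic_Functions.char (distr M borel Y) s" .
    qed
  qed
  hence "measure (distr N borel Y) B = measure (distr M borel Y) B" by simp
  hence *: "measure N (Y -` B \<inter> space M) = prob (Y -` B \<inter> space M)"
    by (simp add: measure_distr N_def)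
  have int_ind: "integrable M (\<lambda>\<omega>. indicator B (Y \<omega>) :: real)"
    by (rule integrable_const_bound[of _ 1]) (auto simp: indicator_def)
  have int_find: "integrable M (\<lambda>\<omega>. f \<omega> * indicator B (Y \<omega>))"
    by (rule integrable_const_bound[of _ K]) (use bound order_trans[OF abs_ge_zero bound] in \<open>auto simp: indicator_def\<close>)
  have E_ind: "expectation (\<lambda>\<omega>. indicator B (Y \<omega>)) = prob (Y -` B \<inter> space M)"
    by (simp add: indicator_vimage[unfolded comp_def, symmetric] Int_commute)
  have "measure N (Y -` B \<inter> space M) = (\<integral>\<omega>. indicator B (Y \<omega>) \<partial>N)"
    by (simp add: indicator_vimage[unfolded comp_def, symmetric] Int_commute N_def)
  also have "\<dots> = (\<integral>\<omega>. (g \<omega> / m) *\<^sub>R indicator B (Y \<omega>) \<partial>M)"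
    unfolding N_def by (rule integral_density) (use g_nn in auto)
  also have "\<dots> = (\<integral>\<omega>. (1 / m) * (f \<omega> * indicator B (Y \<omega>) + (K + 1) * indicator B (Y \<omega>)) \<partial>M)"
    by (rule Bochner_Integration.integral_cong) (auto simp: g_def algebra_simps add_divide_distrib)
  also have "\<dots> = (expectation (\<lambda>\<omega>. f \<omega> * indicator B (Y \<omega>)) + (K + 1) * prob (Y -` B \<inter> space M)) / m"
    using int_ind int_find by (simp add: E_ind)
  finally show ?thesis using m * by (simp add: m_eq field_simps)
qed

text \<open>The previous lemma is applied twice. Taking for \<open>f\<close> the bounded real
  functions cos(t X) and sin(t X) replaces cis(s Y) by an indicator of \<open>Y\<close>; taking that
  indicator for \<open>f\<close>, with \<open>X\<close> as the variable, then replaces cis(t X) by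
  an indicator of \<open>X\<close>. This gives the product rule on rectangles.\<close>

lemma indep_var_of_characteristic:
  fixes X Y :: "'a \<Rightarrow> real"
  assumes [measurable]: "random_variable borel X" "random_variable borel Y"
    and char: "\<And>t s. expectation (\<lambda>\<omega>. cis (t * X \<omega> + s * Y \<omega>)) =
      expectation (\<lambda>\<omega>. cis (t * X \<omega>)) * expectation (\<lambda>\<omega>. cis (s * Y \<omega>))"
  shows "indep_var borel X borel Y"
proof -
  note int = integrable_cis
  \<comment> \<open>Euler's formula combines the hypothesis at \<open>t\<close> and at
    \<open>- t\<close>; a difference instead of a sum gives \<open>sin\<close> below.\<close>
  have cos: "expectation (\<lambda>\<omega>. cos (t * X \<omega>) *\<^sub>R cis (s * Y \<omega>)) =
      expectation (\<lambda>\<omega>. cos (t * X \<omega>)) *\<^sub>R expectation (\<lambda>\<omega>. cis (s * Y \<omega>))" for t s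
  proof -
    have "expectation (\<lambda>\<omega>. cos (t * X \<omega>) *\<^sub>R cis (s * Y \<omega>)) =
      expectation (\<lambda>\<omega>. (cis (t * X \<omega> + s * Y \<omega>) + cis (- t * X \<omega> + s * Y \<omega>)) / 2)"
      by (rule Bochner_Integration.integral_cong) (auto simp: complex_eq_iff cos_add cos_diff sin_add sin_diff)
    also have "\<dots> = (expectation (\<lambda>\<omega>. cis (t * X \<omega>)) + expectation (\<lambda>\<omega>. cis (- t * X \<omega>))) / 2 * expectation (\<lambda>\<omega>. cis (s * Y \<omega>))"
      unfolding integral_divide_zero
      by (subst Bochner_Integration.integral_add) ((auto intro!: int)[2], simp only: char, simp add: ring_distribs)
    also have "expectation (\<lambda>\<omega>. cis (t * X \<omega>)) + expectation (\<lambda>\<omega>. cis (- t * X \<omega>)) = expectation (\<lambda>\<omega>. of_real (2 * cos (t * X \<omega>)))"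
      by (subst Bochner_Integration.integral_add[symmetric])
         ((auto intro!: int)[2], rule Bochner_Integration.integral_cong, auto simp: complex_eq_iff)
    also have "\<dots> = 2 * of_real (expectation (\<lambda>\<omega>. cos (t * X \<omega>)))"
      by (simp only: integral_complex_of_real integral_mult_right_zero) simp
    finally show ?thesis by (simp add: scaleR_conv_of_real)
  qed
  have sin: "expectation (\<lambda>\<omega>. sin (t * X \<omega>) *\<^sub>R cis (s * Y \<omega>)) =
      expectation (\<lambda>\<omega>. sin (t * X \<omega>)) *\<^sub>R expectation (\<lambda>\<omega>. cis (s * Y \<omega>))" for t s
  proof -
    have "expectation (\<lambda>\<omega>. sin (t * X \<omega>) *\<^sub>R cis (s * Y \<omega>)) =
      expectation (\<lambda>\<omega>. (cis (t * X \<omega> + s * Y \<omega>) - cis (- t * X \<omega> + s * Y \<omega>)) / (2 * \<i>))"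
      by (rule Bochner_Integration.integral_cong) (auto simp: complex_eq_iff cos_add cos_diff sin_add sin_diff)
    also have "\<dots> = (expectation (\<lambda>\<omega>. cis (t * X \<omega>)) - expectation (\<lambda>\<omega>. cis (- t * X \<omega>))) / (2 * \<i>) * expectation (\<lambda>\<omega>. cis (s * Y \<omega>))"
      unfolding integral_divide_zero
      by (subst Bochner_Integration.integral_diff) ((auto intro!: int)[2], simp only: char, simp add: ring_distribs)
    also have "expectation (\<lambda>\<omega>. cis (t * X \<omega>)) - expectation (\<lambda>\<omega>. cis (- t * X \<omega>)) = expectation (\<lambda>\<omega>. 2 * \<i> * of_real (sin (t * X \<omega>)))"
      by (subst Bochner_Integration.integral_diff[symmetric])
         ((auto intro!: int)[2], rule Bochner_Integration.integral_cong, auto simp: complex_eq_iff)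
    also have "\<dots> = 2 * \<i> * of_real (expectation (\<lambda>\<omega>. sin (t * X \<omega>)))"
      by (simp only: integral_complex_of_real integral_mult_right_zero)
    finally show ?thesis by (simp add: scaleR_conv_of_real)
  qed
  \<comment> \<open>Halfway point: \<open>Y\<close> already enters through a Borel set,
    \<open>X\<close> still through its characteristic function, whose real and imaginary parts are
    the \<open>cos\<close> and \<open>sin\<close> cases.\<close>
  have mixed: "expectation (\<lambda>\<omega>. indicator B (Y \<omega>) *\<^sub>R cis (t * X \<omega>)) =
      expectation (\<lambda>\<omega>. indicator B (Y \<omega>)) *\<^sub>R expectation (\<lambda>\<omega>. cis (t * X \<omega>))"
    if B [measurable]: "B \<in> sets borel" for B t
  proof -
    have "expectation (\<lambda>\<omega>. cos (t * X \<omega>) * indicator B (Y \<omega>)) = expectation (\<lambda>\<omega>. cos (t * X \<omega>)) * prob (Y -` B \<inter> space M)"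
      by (rule expectation_indicator_eq_of_characteristic[of _ _ 1]) (use cos in auto)
    moreover have "expectation (\<lambda>\<omega>. sin (t * X \<omega>) * indicator B (Y \<omega>)) = expectation (\<lambda>\<omega>. sin (t * X \<omega>)) * prob (Y -` B \<inter> space M)"
      by (rule expectation_indicator_eq_of_characteristic[of _ _ 1]) (use sin in auto)
    moreover have "expectation (\<lambda>\<omega>. indicator B (Y \<omega>)) = prob (Y -` B \<inter> space M)"
      by (simp add: indicator_vimage[unfolded comp_def, symmetric] Int_commute)
    moreover have "integrable M (\<lambda>\<omega>. indicator B (Y \<omega>) *\<^sub>R cis (t * X \<omega>))"
      by (rule integrable_const_bound[of _ 1]) (auto simp: indicator_def)
    ultimately show ?thesis
      by (auto simp: complex_eq_iff integral_Re[symmetric] integral_Im[symmetric] int mult.commute simp del: integral_Re integral_Im)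
  qed
  have "distr M borel X \<Otimes>\<^sub>M distr M borel Y = distr M (borel \<Otimes>\<^sub>M borel) (\<lambda>\<omega>. (X \<omega>, Y \<omega>))"
  proof (rule pair_measure_eqI)
    show "sigma_finite_measure (distr M borel X)" "sigma_finite_measure (distr M borel Y)"
      by (simp_all add: prob_space_distr prob_space_imp_sigma_finite)
    show "sets (distr M borel X \<Otimes>\<^sub>M distr M borel Y) = sets (distr M (borel \<Otimes>\<^sub>M borel) (\<lambda>\<omega>. (X \<omega>, Y \<omega>)))"
      by (simp cong: sets_pair_measure_cong)
    fix A B assume "A \<in> sets (distr M borel X)" "B \<in> sets (distr M borel Y)"
    hence [measurable]: "A \<in> sets borel" "B \<in> sets borel" by auto
    \<comment> \<open>Second use of the uniqueness argument, now with the indicator of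
      \<open>Y\<close> as the weight and \<open>X\<close> as the tested variable.\<close>
    have "expectation (\<lambda>\<omega>. indicator B (Y \<omega>) * indicator A (X \<omega>)) = expectation (\<lambda>\<omega>. indicator B (Y \<omega>)) * prob (X -` A \<inter> space M)"
      by (rule expectation_indicator_eq_of_characteristic[of _ _ 1]) (use mixed in \<open>auto simp: indicator_def\<close>)
    also have "expectation (\<lambda>\<omega>. indicator B (Y \<omega>)) = prob (Y -` B \<inter> space M)"
      by (simp add: indicator_vimage[unfolded comp_def, symmetric] Int_commute)
    also have "expectation (\<lambda>\<omega>. indicat_real B (Y \<omega>) * indicat_real A (X \<omega>)) =
       expectation (indicat_real ((\<lambda>\<omega>. (X \<omega>, Y \<omega>)) -` (A \<times> B) \<inter> space M))"
      by (rule Bochner_Integration.integral_cong) (auto simp: indicator_def)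
    also have "\<dots> = prob ((\<lambda>\<omega>. (X \<omega>, Y \<omega>)) -` (A \<times> B) \<inter> space M)"
      by simp
    finally show "emeasure (distr M borel X) A * emeasure (distr M borel Y) B = emeasure (distr M (borel \<Otimes>\<^sub>M borel) (\<lambda>\<omega>. (X \<omega>, Y \<omega>))) (A \<times> B)"
      by (simp add: emeasure_distr emeasure_eq_measure ennreal_mult[symmetric] mult.commute)
  qed
  thus ?thesis by (simp add: indep_var_distribution_eq)
qed

section \<open>Centred Gaussians on the real line\<close>

text \<open>A centred point mass sits at 0, where both claims hold with variance 0; otherwise
  rescaling leads to the standard normal law. One formula thus covers the degenerate variables,
  which have no density.\<close>

lemma gaussian_rv_centered:
  assumes "gaussian_rv M X" and mean: "expectation X = 0"
  shows "integrable M (\<lambda>\<omega>. (X \<omega>)\<^sup>2)"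
    and "expectation (\<lambda>\<omega>. cis (X \<omega>)) = exp (- expectation (\<lambda>\<omega>. (X \<omega>)\<^sup>2) / 2)"
proof -
  have "integrable M (\<lambda>\<omega>. (X \<omega>)\<^sup>2) \<and>
      expectation (\<lambda>\<omega>. cis (X \<omega>)) = exp (- expectation (\<lambda>\<omega>. (X \<omega>)\<^sup>2) / 2)"
    using assms(1) unfolding gaussian_rv_def
  proof (elim disjE exE conjE)
    fix \<mu> assume X [measurable]: "random_variable borel X" and law: "distr M borel X = return borel \<mu>"
    have "AE x in distr M borel X. x = \<mu>" unfolding law by (simp add: AE_return)
    hence "AE \<omega> in M. X \<omega> = \<mu>" by (simp add: AE_distr_iff)
    hence "expectation X = \<mu>"
      by (subst integral_cong_AE[of _ _ "\<lambda>_. \<mu>"]) (auto simp: prob_space)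
    with mean \<open>AE \<omega> in M. X \<omega> = \<mu>\<close> have AE: "AE \<omega> in M. X \<omega> = 0" by simp
    have "integrable M (\<lambda>\<omega>. (X \<omega>)\<^sup>2)"
      by (subst integrable_cong_AE[of _ _ "\<lambda>_. 0"]) (use AE in auto)
    moreover have "expectation (\<lambda>\<omega>. (X \<omega>)\<^sup>2) = 0"
      by (subst integral_cong_AE[of _ _ "\<lambda>_. 0"]) (use AE in auto)
    moreover have "expectation (\<lambda>\<omega>. cis (X \<omega>)) = 1"
      by (subst integral_cong_AE[of _ _ "\<lambda>_. 1"]) (use AE in \<open>auto simp: prob_space\<close>)
    ultimately show ?thesis by simp
  next
    fix \<mu> \<sigma> :: real assume \<sigma>: "\<sigma> > 0" and D: "distributed M lborel X (\<lambda>t. ennreal (normal_density \<mu> \<sigma> t))"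
    have [measurable]: "random_variable borel X" using distributed_measurable[OF D] by simp
    have \<mu>: "\<mu> = 0" using normal_distributed_expectation[OF \<sigma> D] mean by simp
    have "integrable lborel (\<lambda>x. normal_density \<mu> \<sigma> x * (x - \<mu>)^2)"
      by (rule integrable_normal_moment[OF \<sigma>])
    hence "integrable M (\<lambda>\<omega>. (X \<omega>)\<^sup>2)"
      using distributed_integrable[OF D, of "\<lambda>x. x\<^sup>2"] by (simp add: \<mu>)
    moreover have "expectation (\<lambda>\<omega>. (X \<omega>)\<^sup>2) = \<sigma>\<^sup>2"
      using normal_distributed_variance[OF \<sigma> D] mean by simp
    moreover have "expectation (\<lambda>\<omega>. cis (X \<omega>)) = exp (- \<sigma>\<^sup>2 / 2)"
    proof -
      have std: "distributed M lborel (\<lambda>\<omega>. X \<omega> / \<sigma>) std_normal_density"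
        using D normal_standard_normal_convert[OF \<sigma>, of X \<mu>] by (simp add: \<mu>)
      have "exp (- \<sigma>\<^sup>2 / 2) = char std_normal_distribution \<sigma>"
        by (simp add: char_std_normal_distribution)
      also have "\<dots> = char (distr M lborel (\<lambda>\<omega>. X \<omega> / \<sigma>)) \<sigma>"
        by (simp add: distributed_distr_eq_density[OF std])
      also have "\<dots> = expectation (\<lambda>\<omega>. cis (X \<omega>))"
        unfolding char_def by (subst integral_distr) (use \<sigma> in \<open>auto simp: cis_conv_exp\<close>)
      finally show ?thesis by simp
    qed
    ultimately show ?thesis by simp
  qed
  thus "integrable M (\<lambda>\<omega>. (X \<omega>)\<^sup>2)"
    and "expectation (\<lambda>\<omega>. cis (X \<omega>)) = exp (- expectation (\<lambda>\<omega>. (X \<omega>)\<^sup>2) / 2)" by auto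
qed

text \<open>Uniqueness of characteristic functions, after rescaling to the standard normal law.
  Positive variance is what allows a density.\<close>

lemma distributed_normal_of_characteristic:
  fixes X :: "'a \<Rightarrow> real"
  assumes X [measurable]: "random_variable borel X" and \<sigma>: "\<sigma> > 0"
    and char: "\<And>t. expectation (\<lambda>\<omega>. cis (t * X \<omega>)) = exp (- (\<sigma> * t)\<^sup>2 / 2)"
  shows "distributed M lborel X (normal_density 0 \<sigma>)"
proof -
  have "distr M borel (\<lambda>\<omega>. X \<omega> / \<sigma>) = std_normal_distribution"
  proof (rule Levy_uniqueness)
    show "real_distribution (distr M borel (\<lambda>\<omega>. X \<omega> / \<sigma>))" by (rule real_distribution_distr) simp
    show "real_distribution std_normal_distribution" by (rule real_dist_normal_dist)
    show "Characteristic_Functions.char (distr M borel (\<lambda>\<omega>. X \<omega> / \<sigma>)) = Characteristic_Functions.char std_normal_distribution"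
    proof
      fix t
      have "Characteristic_Functions.char (distr M borel (\<lambda>\<omega>. X \<omega> / \<sigma>)) t = expectation (\<lambda>\<omega>. cis ((t / \<sigma>) * X \<omega>))"
        unfolding char_def by (subst integral_distr) (auto simp: cis_conv_exp)
      also have "\<dots> = exp (- t\<^sup>2 / 2)" using \<sigma> by (simp only: char) simp
      finally show "Characteristic_Functions.char (distr M borel (\<lambda>\<omega>. X \<omega> / \<sigma>)) t = Characteristic_Functions.char std_normal_distribution t"
        by (simp add: char_std_normal_distribution)
    qed
  qed
  hence "distributed M lborel (\<lambda>\<omega>. X \<omega> / \<sigma>) std_normal_density"
    by (simp add: distributed_def cong: distr_cong)
  thus ?thesis using normal_standard_normal_convert[OF \<sigma>, of X 0] by simp
qed

section \<open>Complex Gaussians described by their moments\<close>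

text \<open>As \<open>w\<close> varies, \<open>Re (w * z \<omega>)\<close> runs through all real
  linear functionals of the pair (real part, imaginary part), so the last conjunct is the planar
  characteristic function; its exponent is minus half the variance of that functional. Unlike a
  density, it makes sense for \<open>cmod P = C\<close>, and it is easy to follow under scaling and
  independent sums.\<close>

definition gaussian_with_moments :: "('a \<Rightarrow> complex) \<Rightarrow> real \<Rightarrow> complex \<Rightarrow> bool" where
  "gaussian_with_moments z C P \<longleftrightarrow>
     integrable M z \<and> expectation z = 0 \<and>
     integrable M (\<lambda>\<omega>. (cmod (z \<omega>))\<^sup>2) \<and> expectation (\<lambda>\<omega>. (cmod (z \<omega>))\<^sup>2) = C \<and>
     expectation (\<lambda>\<omega>. (z \<omega>)\<^sup>2) = P \<and>
     (\<forall>w. expectation (\<lambda>\<omega>. cis (Re (w * z \<omega>))) = exp (- ((cmod w)\<^sup>2 * C + Re (w\<^sup>2 * P)) / 4))"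

lemma integrable_power2_complex:
  fixes z :: "'a \<Rightarrow> complex"
  assumes "integrable M z" "integrable M (\<lambda>\<omega>. (cmod (z \<omega>))\<^sup>2)"
  shows "integrable M (\<lambda>\<omega>. (z \<omega>)\<^sup>2)"
  using assms(2) borel_measurable_integrable[OF assms(1)]
  by (rule_tac Bochner_Integration.integrable_bound) (auto simp: norm_power)

text \<open>This is (Re u)^2 = (|u|^2 + Re(u^2)) / 2 for u = w z. In expectation it expresses the
  variance of every real functional of \<open>z\<close> through covariance and
  pseudo-covariance.\<close>

lemma Re_mult_power2: "(Re (w * z))\<^sup>2 = ((cmod w)\<^sup>2 * (cmod z)\<^sup>2 + Re (w\<^sup>2 * z\<^sup>2)) / 2"
  unfolding cmod_power2 by (simp add: power2_eq_square algebra_simps)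

text \<open>Joint Gaussianity makes each real functional of \<open>z\<close> a centred real
  Gaussian, so its characteristic function depends only on its variance, which the two complex
  moments determine.\<close>

lemma gaussian_with_moments_of_complex_gaussian:
  assumes z: "complex_gaussian M z" "zero_mean M z"
  shows "gaussian_with_moments z (covariance M z) (pseudo_covariance M z)"
proof -
  have int: "integrable M z" and mean: "expectation z = 0" using z by (auto simp: zero_mean_def)
  have [measurable]: "random_variable borel z" using int by simp
  have G: "gaussian_rv M (\<lambda>\<omega>. Re (w * z \<omega>))" for w
  proof -
    have "gaussian_rv M (\<lambda>\<omega>. Re w * Re (z \<omega>) + (- Im w) * Im (z \<omega>))"
      using z(1) unfolding complex_gaussian_def jointly_gaussian_def by blast
    thus ?thesis by simp
  qed
  have mean': "expectation (\<lambda>\<omega>. Re (w * z \<omega>)) = 0" for w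
    by (subst integral_Re) (use int mean in simp_all)
  note int_Re = gaussian_rv_centered(1)[OF G mean']
  \<comment> \<open>The choices \<open>w = 1\<close> and \<open>w = \<i>\<close> give the squares of
    the real and imaginary parts.\<close>
  have int2: "integrable M (\<lambda>\<omega>. (cmod (z \<omega>))\<^sup>2)"
    using Bochner_Integration.integrable_add[OF int_Re[of 1] int_Re[of \<i>]] by (simp add: cmod_power2)
  note int_sq = integrable_power2_complex[OF int int2]
  have cov: "covariance M z = expectation (\<lambda>\<omega>. (cmod (z \<omega>))\<^sup>2)"
    unfolding covariance_def complex_norm_square[symmetric] integral_complex_of_real by simp
  have pcov: "pseudo_covariance M z = expectation (\<lambda>\<omega>. (z \<omega>)\<^sup>2)"
    by (simp add: pseudo_covariance_def power2_eq_square)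
  have var: "expectation (\<lambda>\<omega>. (Re (w * z \<omega>))\<^sup>2) = ((cmod w)\<^sup>2 * covariance M z + Re (w\<^sup>2 * pseudo_covariance M z)) / 2" for w
  proof -
    have "expectation (\<lambda>\<omega>. Re (w\<^sup>2 * (z \<omega>)\<^sup>2)) = Re (w\<^sup>2 * pseudo_covariance M z)"
      by (subst integral_Re) (use int_sq in \<open>simp_all add: pcov\<close>)
    moreover have "integrable M (\<lambda>\<omega>. Re (w\<^sup>2 * (z \<omega>)\<^sup>2))"
      by (intro integrable_Re integrable_mult_right int_sq)
    ultimately show ?thesis unfolding Re_mult_power2 using int2 by (simp add: cov del: times_complex.simps)
  qed
  have "expectation (\<lambda>\<omega>. cis (Re (w * z \<omega>))) =
      exp (- ((cmod w)\<^sup>2 * covariance M z + Re (w\<^sup>2 * pseudo_covariance M z)) / 4)" for w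
    unfolding gaussian_rv_centered(2)[OF G mean'] var
    by (simp add: add_divide_distrib del: times_complex.simps)
  thus ?thesis unfolding gaussian_with_moments_def
    using int mean int2 cov pcov by simp
qed

text \<open>Multiplication by \<open>h\<close> moves the argument \<open>w\<close> of the
  characteristic function to \<open>w * h\<close>.\<close>

lemma gaussian_with_moments_mult:
  assumes "gaussian_with_moments z C P"
  shows "gaussian_with_moments (\<lambda>\<omega>. h * z \<omega>) ((cmod h)\<^sup>2 * C) (h\<^sup>2 * P)"
proof -
  have "expectation (\<lambda>\<omega>. cis (Re (w * (h * z \<omega>)))) = exp (- ((cmod w)\<^sup>2 * ((cmod h)\<^sup>2 * C) + Re (w\<^sup>2 * (h\<^sup>2 * P))) / 4)" for w
  proof -
    have "expectation (\<lambda>\<omega>. cis (Re ((w * h) * z \<omega>))) = exp (- ((cmod (w * h))\<^sup>2 * C + Re ((w * h)\<^sup>2 * P)) / 4)"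
      using assms unfolding gaussian_with_moments_def by blast
    thus ?thesis by (simp only: norm_mult power_mult_distrib mult.assoc)
  qed
  with assms show ?thesis unfolding gaussian_with_moments_def
    by (simp add: norm_mult power_mult_distrib)
qed

text \<open>Independence and zero means annihilate both cross moments: that of \<open>z1\<close>
  with \<open>z2\<close>, which enters the pseudo-covariance, and that of \<open>z1\<close> with the
  conjugate of \<open>z2\<close>, which enters the covariance. The characteristic functions
  multiply.\<close>

lemma gaussian_with_moments_add:
  assumes z1: "gaussian_with_moments z1 C1 P1" and z2: "gaussian_with_moments z2 C2 P2"
    and indep: "indep_var borel z1 borel z2"
  shows "gaussian_with_moments (\<lambda>\<omega>. z1 \<omega> + z2 \<omega>) (C1 + C2) (P1 + P2)"
proof -
  note z1' = z1[unfolded gaussian_with_moments_def] and z2' = z2[unfolded gaussian_with_moments_def]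
  have int1: "integrable M z1" and int2: "integrable M z2" using z1' z2' by auto
  have [measurable]: "random_variable borel z1" "random_variable borel z2" using int1 int2 by auto
  have indep': "indep_var borel z1 borel (\<lambda>\<omega>. cnj (z2 \<omega>))"
    using indep_var_compose[OF indep, of id borel cnj borel]
    by (simp add: comp_def borel_measurable_continuous_onI continuous_intros)
  have int2': "integrable M (\<lambda>\<omega>. cnj (z2 \<omega>))" using int2 by simp
  have cross: "integrable M (\<lambda>\<omega>. z1 \<omega> * z2 \<omega>)" "expectation (\<lambda>\<omega>. z1 \<omega> * z2 \<omega>) = 0"
    using indep_var_integrable[OF indep int1 int2] indep_var_lebesgue_integral[OF indep int1 int2] z1' by auto
  have cross': "integrable M (\<lambda>\<omega>. z1 \<omega> * cnj (z2 \<omega>))" "expectation (\<lambda>\<omega>. z1 \<omega> * cnj (z2 \<omega>)) = 0"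
    using indep_var_integrable[OF indep' int1 int2'] indep_var_lebesgue_integral[OF indep' int1 int2'] z1' by auto
  have cross_Re: "integrable M (\<lambda>\<omega>. Re (z1 \<omega> * cnj (z2 \<omega>)))" "expectation (\<lambda>\<omega>. Re (z1 \<omega> * cnj (z2 \<omega>))) = 0"
    using integrable_Re[OF cross'(1)] integral_Re[OF cross'(1)] cross'(2) by (simp_all del: times_complex.simps)
  have sq: "integrable M (\<lambda>\<omega>. (z1 \<omega>)\<^sup>2)" "integrable M (\<lambda>\<omega>. (z2 \<omega>)\<^sup>2)"
    using z1' z2' by (auto intro: integrable_power2_complex)
  have norm_add: "(cmod (z1 \<omega> + z2 \<omega>))\<^sup>2 = (cmod (z1 \<omega>))\<^sup>2 + (cmod (z2 \<omega>))\<^sup>2 + 2 * Re (z1 \<omega> * cnj (z2 \<omega>))" for \<omega>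
    unfolding cmod_power2 by (simp add: power2_eq_square algebra_simps)
  have "integrable M (\<lambda>\<omega>. (cmod (z1 \<omega> + z2 \<omega>))\<^sup>2)"
    unfolding norm_add using z1' z2' cross_Re by (intro Bochner_Integration.integrable_add integrable_mult_right) auto
  moreover have "expectation (\<lambda>\<omega>. (cmod (z1 \<omega> + z2 \<omega>))\<^sup>2) = C1 + C2"
    unfolding norm_add using z1' z2' cross_Re by (simp del: times_complex.simps)
  moreover have "expectation (\<lambda>\<omega>. (z1 \<omega> + z2 \<omega>)\<^sup>2) = P1 + P2"
  proof -
    have "expectation (\<lambda>\<omega>. (z1 \<omega> + z2 \<omega>)\<^sup>2) = expectation (\<lambda>\<omega>. (z1 \<omega>)\<^sup>2 + (z2 \<omega>)\<^sup>2 + 2 * (z1 \<omega> * z2 \<omega>))"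
      by (simp add: power2_sum mult.assoc)
    also have "\<dots> = P1 + P2" using z1' z2' sq cross by simp
    finally show ?thesis .
  qed
  moreover have "expectation (\<lambda>\<omega>. cis (Re (w * (z1 \<omega> + z2 \<omega>)))) = exp (- ((cmod w)\<^sup>2 * (C1 + C2) + Re (w\<^sup>2 * (P1 + P2))) / 4)" for w
  proof -
    have [measurable]: "(\<lambda>z. cis (Re (w * z))) \<in> borel_measurable borel" by simp
    have ind: "indep_var borel (\<lambda>\<omega>. cis (Re (w * z1 \<omega>))) borel (\<lambda>\<omega>. cis (Re (w * z2 \<omega>)))"
      using indep_var_compose[OF indep, of "\<lambda>z. cis (Re (w * z))" borel "\<lambda>z. cis (Re (w * z))" borel]
      by (simp add: comp_def del: times_complex.simps)
    have "expectation (\<lambda>\<omega>. cis (Re (w * (z1 \<omega> + z2 \<omega>)))) = expectation (\<lambda>\<omega>. cis (Re (w * z1 \<omega>)) * cis (Re (w * z2 \<omega>)))"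
      by (simp only: distrib_left plus_complex.simps cis_mult)
    also have "\<dots> = expectation (\<lambda>\<omega>. cis (Re (w * z1 \<omega>))) * expectation (\<lambda>\<omega>. cis (Re (w * z2 \<omega>)))"
      by (rule indep_var_lebesgue_integral[OF ind]) (intro integrable_cis; simp)+
    also have "\<dots> = of_real (exp (- ((cmod w)\<^sup>2 * C1 + Re (w\<^sup>2 * P1)) / 4) * exp (- ((cmod w)\<^sup>2 * C2 + Re (w\<^sup>2 * P2)) / 4))"
      using z1' z2' by (simp only: of_real_mult)
    also have "\<dots> = of_real (exp (- ((cmod w)\<^sup>2 * (C1 + C2) + Re (w\<^sup>2 * (P1 + P2))) / 4))"
      by (simp add: exp_add[symmetric] field_simps)
    finally show ?thesis by simp
  qed
  ultimately show ?thesis unfolding gaussian_with_moments_def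
    using z1' z2' by simp
qed

end

section \<open>Lebesgue measure on the complex plane\<close>

text \<open>\<open>lborel\<close> is determined by its values on boxes, and a complex box is a
  product of two intervals. This gives access to iterated integrals over real and imaginary
  parts.\<close>

lemma distr_Complex_lborel:
  "distr (lborel \<Otimes>\<^sub>M lborel) borel (\<lambda>(x, y). Complex x y) = lborel"
proof (rule lborel_eqI[symmetric])
  have [measurable]: "(\<lambda>(x, y). Complex x y) \<in> borel_measurable (borel \<Otimes>\<^sub>M borel)"
    unfolding Complex_eq case_prod_beta by measurable
  fix l u :: complex assume le: "\<And>b. b \<in> Basis \<Longrightarrow> l \<bullet> b \<le> u \<bullet> b"
  have "(\<lambda>(x, y). Complex x y) -` box l u \<inter> space (lborel \<Otimes>\<^sub>M lborel) =
      {Re l<..<Re u} \<times> {Im l<..<Im u}"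
    by (auto simp: box_def Basis_complex_def space_pair_measure)
  moreover have "Re l \<le> Re u" "Im l \<le> Im u"
    using le[of 1] le[of \<i>] by (auto simp: Basis_complex_def)
  ultimately show "emeasure (distr (lborel \<Otimes>\<^sub>M lborel) borel (\<lambda>(x, y). Complex x y)) (box l u) =
      (\<Prod>b\<in>Basis. (u - l) \<bullet> b)"
    by (simp add: emeasure_distr lborel.emeasure_pair_measure_Times Basis_complex_def ennreal_mult)
qed simp

lemma nn_integral_lborel_complex:
  fixes f :: "complex \<Rightarrow> ennreal"
  assumes [measurable]: "f \<in> borel_measurable borel"
  shows "(\<integral>\<^sup>+ z. f z \<partial>lborel) = (\<integral>\<^sup>+ x. \<integral>\<^sup>+ y. f (Complex x y) \<partial>lborel \<partial>lborel)"
proof -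
  have [measurable]: "(\<lambda>p. Complex (fst p) (snd p)) \<in> borel_measurable (borel \<Otimes>\<^sub>M borel)"
    unfolding Complex_eq by measurable
  show ?thesis
    unfolding distr_Complex_lborel[symmetric] case_prod_beta
    by (subst nn_integral_distr) (auto simp: lborel.nn_integral_fst[symmetric])
qed

lemma nn_integral_lborel_shift:
  fixes f :: "'b::euclidean_space \<Rightarrow> ennreal"
  assumes [measurable]: "f \<in> borel_measurable borel"
  shows "(\<integral>\<^sup>+ x. f (c + x) \<partial>lborel) = (\<integral>\<^sup>+ x. f x \<partial>lborel)"
proof -
  have "(\<integral>\<^sup>+ x. f x \<partial>lborel) = (\<integral>\<^sup>+ x. f x \<partial>distr lborel borel ((+) c))"
    by (simp only: lborel_distr_plus)
  also have "\<dots> = (\<integral>\<^sup>+ x. f (c + x) \<partial>lborel)"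
    by (subst nn_integral_distr) auto
  finally show ?thesis ..
qed

section \<open>The density of an improper complex Gaussian\<close>

text \<open>C^2 - |P|^2 is four times the determinant of the covariance matrix of the real and
  imaginary parts. For P = 0 and C > 0 the formula reduces to the circularly symmetric density
  exp(-|z|^2 / C) / (pi C).\<close>

definition improper_normal_density :: "real \<Rightarrow> complex \<Rightarrow> complex \<Rightarrow> real" where
  "improper_normal_density C P z =
     exp (- (C * (cmod z)\<^sup>2 - Re (cnj P * z\<^sup>2)) / (C\<^sup>2 - (cmod P)\<^sup>2)) / (pi * sqrt (C\<^sup>2 - (cmod P)\<^sup>2))"

lemma borel_measurable_improper_normal_density [measurable]:
  "improper_normal_density C P \<in> borel_measurable borel"
  unfolding improper_normal_density_def[abs_def]
  by simp

lemma improper_normal_density_pos: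
  assumes "cmod P < C"
  shows "improper_normal_density C P z > 0"
proof -
  have "(cmod P)\<^sup>2 < C\<^sup>2" using assms by (intro power_strict_mono) auto
  thus ?thesis by (simp add: improper_normal_density_def)
qed

(* For z = X + i Y with moments C and P, the slope k makes Y - k X uncorrelated with X. *)
lemma improper_normal_density_factor:
  assumes "cmod P < C"
  defines "k \<equiv> Im P / (C + Re P)"
  shows "normal_density 0 (sqrt ((C + Re P) / 2)) x *
      normal_density 0 (sqrt ((C\<^sup>2 - (cmod P)\<^sup>2) / (2 * (C + Re P)))) (y - k * x) =
    improper_normal_density C P (Complex x y)"
proof -
  define S where "S = C + Re P"
  define D where "D = C\<^sup>2 - (cmod P)\<^sup>2"
  have S: "S > 0" using assms abs_Re_le_cmod[of P] by (auto simp: S_def)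
  have "(cmod P)\<^sup>2 < C\<^sup>2" using assms by (intro power_strict_mono) auto
  hence D: "D > 0" by (simp add: D_def)
  have D_eq: "D = C\<^sup>2 - (Re P)\<^sup>2 - (Im P)\<^sup>2" by (simp add: D_def cmod_power2)
  have expo: "x\<^sup>2 / S + (y - k * x)\<^sup>2 * S / D = (C * (x\<^sup>2 + y\<^sup>2) - (Re P * (x\<^sup>2 - y\<^sup>2) + 2 * Im P * x * y)) / D"
  proof -
    have kS: "k * S = Im P" using S by (simp add: k_def S_def)
    \<comment> \<open>Multiplying by \<open>S * D\<close> clears the denominators and lets
      \<open>k\<close> occur only as \<open>k * S\<close>, so that a polynomial identity
      remains.\<close>
    have "(x\<^sup>2 / S + (y - k * x)\<^sup>2 * S / D) * (S * D) = x\<^sup>2 * D + (S * y - (k * S) * x)\<^sup>2"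
      using S D by (simp add: field_simps power2_eq_square)
    also have "\<dots> = x\<^sup>2 * D + (S * y - Im P * x)\<^sup>2" by (simp only: kS)
    also have "\<dots> = (C * (x\<^sup>2 + y\<^sup>2) - (Re P * (x\<^sup>2 - y\<^sup>2) + 2 * Im P * x * y)) / D * (S * D)"
      using D by (simp add: D_eq S_def power2_eq_square) (simp add: algebra_simps)
    finally have "(x\<^sup>2 / S + (y - k * x)\<^sup>2 * S / D) * (S * D) =
        (C * (x\<^sup>2 + y\<^sup>2) - (Re P * (x\<^sup>2 - y\<^sup>2) + 2 * Im P * x * y)) / D * (S * D)" .
    moreover have "S * D \<noteq> 0" using S D by simp
    ultimately show ?thesis using mult_right_cancel by blast
  qed
  have "normal_density 0 (sqrt (S / 2)) x * normal_density 0 (sqrt (D / (2 * S))) (y - k * x) =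
     exp (- (x\<^sup>2 / S + (y - k * x)\<^sup>2 * S / D)) / (sqrt (pi * S) * sqrt (pi * (D / S)))"
    using S D by (simp add: normal_density_def exp_add[symmetric] field_simps)
  also have "sqrt (pi * S) * sqrt (pi * (D / S)) = pi * sqrt D"
    using S D by (simp add: real_sqrt_mult[symmetric] real_sqrt_divide) (simp add: real_sqrt_mult)
  also have "exp (- (x\<^sup>2 / S + (y - k * x)\<^sup>2 * S / D)) / (pi * sqrt D) = improper_normal_density C P (Complex x y)"
  proof -
    have "Re (cnj P * (Complex x y)\<^sup>2) = Re P * (x\<^sup>2 - y\<^sup>2) + 2 * Im P * x * y"
      by (simp add: power2_eq_square algebra_simps)
    thus ?thesis unfolding expo unfolding improper_normal_density_def D_def cmod_power2[of "Complex x y"]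
      by (simp add: diff_divide_distrib)
  qed
  finally show ?thesis by (simp only: S_def D_def)
qed

context prob_space
begin

lemma distributed_improper_normal:
  assumes z: "gaussian_with_moments z C P" and PC: "cmod P < C"
  shows "distributed M lborel z (improper_normal_density C P)"
proof -
  \<comment> \<open>\<open>a\<close> and \<open>b\<close> are the variances of \<open>X\<close> and
    \<open>W\<close>, and \<open>k\<close> is the regression coefficient of the imaginary part on
    the real part. The strict bound \<open>PC\<close> makes both variances positive.\<close>
  define a where "a = (C + Re P) / 2"
  define k where "k = Im P / (C + Re P)"
  define b where "b = (C\<^sup>2 - (cmod P)\<^sup>2) / (2 * (C + Re P))"
  define X where "X \<omega> = Re (z \<omega>)" for \<omega>
  define W where "W \<omega> = Im (z \<omega>) - k * Re (z \<omega>)" for \<omega>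
  have [measurable]: "random_variable borel z" using z by (auto simp: gaussian_with_moments_def)
  have [measurable]: "random_variable borel X" "random_variable borel W"
    by (simp_all add: X_def[abs_def] W_def[abs_def])
  have S: "C + Re P > 0" using PC abs_Re_le_cmod[of P] by auto
  have "(cmod P)\<^sup>2 < C\<^sup>2" using PC by (intro power_strict_mono) auto
  hence a: "a > 0" and b: "b > 0" using S by (simp_all add: a_def b_def)
  have char: "expectation (\<lambda>\<omega>. cis (t * X \<omega> + s * W \<omega>)) = exp (- (a * t\<^sup>2 + b * s\<^sup>2) / 2)" for t s
  proof -
    \<comment> \<open>Re(w z) = Re w Re z - Im w Im z must equal (t - s k) Re z + s Im z; this
      dictates \<open>w\<close>, including the sign of its imaginary part.\<close>
    define w where "w = Complex (t - s * k) (- s)"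
    have "t * X \<omega> + s * W \<omega> = Re (w * z \<omega>)" for \<omega>
      by (simp add: w_def X_def W_def algebra_simps)
    hence "expectation (\<lambda>\<omega>. cis (t * X \<omega> + s * W \<omega>)) = exp (- ((cmod w)\<^sup>2 * C + Re (w\<^sup>2 * P)) / 4)"
      using z by (simp add: gaussian_with_moments_def del: times_complex.simps)
    moreover have "(cmod w)\<^sup>2 * C + Re (w\<^sup>2 * P) = 2 * (a * t\<^sup>2 + b * s\<^sup>2)"
    proof -
      have k: "k * (C + Re P) = Im P" using S by (simp add: k_def)
      have "b * (2 * (C + Re P)) = C\<^sup>2 - ((Re P)\<^sup>2 + (Im P)\<^sup>2)" using S by (simp add: b_def cmod_power2)
      also have "\<dots> = (C + Re P) * (C - Re P) - Im P * (k * (C + Re P))"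
        unfolding k by (simp add: power2_eq_square algebra_simps)
      also have "\<dots> = (C - Re P - k * Im P) * (C + Re P)" by (simp add: algebra_simps)
      finally have "(2 * b) * (C + Re P) = (C - Re P - k * Im P) * (C + Re P)"
        by (simp only: mult.assoc mult.left_commute)
      moreover have "C + Re P \<noteq> 0" using S by simp
      \<comment> \<open>The variance of \<open>W\<close> is that of the imaginary part less the part
        explained by \<open>X\<close>. With this identity and \<open>k\<close> the mixed terms in
        \<open>t * s\<close> cancel, which is what makes the characteristic function factor.\<close>
      ultimately have b': "2 * b = C - Re P - k * Im P" using mult_right_cancel by blast
      have "(cmod w)\<^sup>2 * C + Re (w\<^sup>2 * P) = (t - s * k)\<^sup>2 * (C + Re P) + s\<^sup>2 * (C - Re P) + 2 * (t - s * k) * s * Im P"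
        unfolding cmod_power2 by (simp add: w_def power2_eq_square algebra_simps)
      also have "\<dots> = t\<^sup>2 * (C + Re P) + s\<^sup>2 * (C - Re P) + s\<^sup>2 * k * (k * (C + Re P)) - 2 * t * s * (k * (C + Re P)) + 2 * (t - s * k) * s * Im P"
        by (simp add: power2_eq_square algebra_simps)
      also have "\<dots> = t\<^sup>2 * (C + Re P) + s\<^sup>2 * (C - Re P - k * Im P)"
        unfolding k by (simp add: power2_eq_square algebra_simps)
      also have "\<dots> = 2 * (a * t\<^sup>2 + b * s\<^sup>2)" unfolding b'[symmetric] by (simp add: a_def field_simps)
      finally show ?thesis .
    qed
    ultimately show ?thesis by simp
  qed
  have char_X: "expectation (\<lambda>\<omega>. cis (t * X \<omega>)) = exp (- (sqrt a * t)\<^sup>2 / 2)" for t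
    using char[of t 0] a by (simp add: power_mult_distrib)
  have char_W: "expectation (\<lambda>\<omega>. cis (s * W \<omega>)) = exp (- (sqrt b * s)\<^sup>2 / 2)" for s
    using char[of 0 s] b by (simp add: power_mult_distrib)
  have "indep_var borel X borel W"
    by (rule indep_var_of_characteristic)
       (use a b in \<open>simp_all add: char char_X char_W exp_add[symmetric] power_mult_distrib add_divide_distrib
          del: of_real_exp flip: of_real_mult\<close>)
  hence indep: "distr M lborel X \<Otimes>\<^sub>M distr M lborel W = distr M (lborel \<Otimes>\<^sub>M lborel) (\<lambda>\<omega>. (X \<omega>, W \<omega>))"
    by (simp add: indep_var_distribution_eq cong: distr_cong sets_pair_measure_cong)
  have DX: "distributed M lborel X (normal_density 0 (sqrt a))"
    by (rule distributed_normal_of_characteristic) (use a char_X in auto)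
  have DW: "distributed M lborel W (normal_density 0 (sqrt b))"
    by (rule distributed_normal_of_characteristic) (use b char_W in auto)
  have joint: "distributed M (lborel \<Otimes>\<^sub>M lborel) (\<lambda>\<omega>. (X \<omega>, W \<omega>))
     (\<lambda>(x, w). ennreal (normal_density 0 (sqrt a) x) * ennreal (normal_density 0 (sqrt b) w))"
    by (rule distributed_joint_indep'[OF _ _ DX DW indep]) (rule sigma_finite_lborel)+
  have [measurable]: "(\<lambda>p. Complex (fst p) (snd p + k * fst p)) \<in> borel_measurable (borel \<Otimes>\<^sub>M borel)"
      "(\<lambda>y. Complex x y) \<in> borel_measurable borel" for x
    unfolding Complex_eq by measurable
  have "distr M lborel z = density lborel (improper_normal_density C P)"
  proof (rule measure_eqI)
    fix A assume "A \<in> sets (distr M lborel z)"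
    hence A [measurable]: "A \<in> sets borel" by simp
    have z_eq: "z \<omega> = Complex (X \<omega>) (W \<omega> + k * X \<omega>)" for \<omega> by (simp add: X_def W_def)
    have "emeasure (distr M lborel z) A = (\<integral>\<^sup>+ \<omega>. indicator A (z \<omega>) \<partial>M)"
      by (subst nn_integral_distr[where M' = lborel and f = "indicator A", symmetric]) auto
    also have "\<dots> = (\<integral>\<^sup>+ \<omega>. (\<lambda>p. indicator A (Complex (fst p) (snd p + k * fst p))) (X \<omega>, W \<omega>) \<partial>M)"
      by (simp add: z_eq[symmetric])
    also have "\<dots> = (\<integral>\<^sup>+ p. (case p of (x, w) \<Rightarrow> ennreal (normal_density 0 (sqrt a) x) * ennreal (normal_density 0 (sqrt b) w)) *
        indicator A (Complex (fst p) (snd p + k * fst p)) \<partial>(lborel \<Otimes>\<^sub>M lborel))"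
      by (rule distributed_nn_integral[OF joint, symmetric]) measurable
    also have "\<dots> = (\<integral>\<^sup>+ x. \<integral>\<^sup>+ w. ennreal (normal_density 0 (sqrt a) x) * ennreal (normal_density 0 (sqrt b) w) *
        indicator A (Complex x (w + k * x)) \<partial>lborel \<partial>lborel)"
      by (subst lborel.nn_integral_fst[symmetric]) (auto simp: case_prod_beta)
    also have "\<dots> = (\<integral>\<^sup>+ x. \<integral>\<^sup>+ y. ennreal (normal_density 0 (sqrt a) x) * ennreal (normal_density 0 (sqrt b) (y - k * x)) *
        indicator A (Complex x y) \<partial>lborel \<partial>lborel)"
    \<comment> \<open>For fixed \<open>x\<close> the substitution y = w + k x is a translation, so
      no Jacobian appears.\<close>
    proof (rule nn_integral_cong)
      fix x :: real
      show "(\<integral>\<^sup>+ w. ennreal (normal_density 0 (sqrt a) x) * ennreal (normal_density 0 (sqrt b) w) *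
          indicator A (Complex x (w + k * x)) \<partial>lborel) =
        (\<integral>\<^sup>+ y. ennreal (normal_density 0 (sqrt a) x) * ennreal (normal_density 0 (sqrt b) (y - k * x)) *
          indicator A (Complex x y) \<partial>lborel)"
        by (subst nn_integral_lborel_shift[of _ "k * x", symmetric]) (auto simp: add.commute)
    qed
    also have "\<dots> = (\<integral>\<^sup>+ x. \<integral>\<^sup>+ y. ennreal (improper_normal_density C P (Complex x y)) * indicator A (Complex x y) \<partial>lborel \<partial>lborel)"
      by (simp add: improper_normal_density_factor[OF PC, symmetric] a_def b_def k_def ennreal_mult)
    also have "\<dots> = (\<integral>\<^sup>+ v. ennreal (improper_normal_density C P v) * indicator A v \<partial>lborel)"
      by (rule nn_integral_lborel_complex[symmetric]) measurable
    also have "\<dots> = emeasure (density lborel (improper_normal_density C P)) A"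
      by (simp add: emeasure_density)
    finally show "emeasure (distr M lborel z) A = emeasure (density lborel (improper_normal_density C P)) A" .
  qed simp
  thus ?thesis by (simp add: distributed_def)
qed

text \<open>The exponent is a quadratic form in \<open>z\<close> whose numerator has expectation C^2
  - |P|^2 up to sign, which cancels against the denominator and leaves -1. The value is minus the
  differential entropy of \<open>z\<close>.\<close>

lemma expectation_ln_improper_normal_density:
  assumes z: "gaussian_with_moments z C P" and PC: "cmod P < C"
  shows "integrable M (\<lambda>\<omega>. ln (improper_normal_density C P (z \<omega>)))"
    and "expectation (\<lambda>\<omega>. ln (improper_normal_density C P (z \<omega>))) =
      - 1 - ln pi - ln (C\<^sup>2 - (cmod P)\<^sup>2) / 2"
proof -
  define D where "D = C\<^sup>2 - (cmod P)\<^sup>2"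
  have "(cmod P)\<^sup>2 < C\<^sup>2" using PC by (intro power_strict_mono) auto
  hence D: "D > 0" by (simp add: D_def)
  note z' = z[unfolded gaussian_with_moments_def]
  have sq: "integrable M (\<lambda>\<omega>. (z \<omega>)\<^sup>2)" using z' by (auto intro: integrable_power2_complex)
  have int_Re: "integrable M (\<lambda>\<omega>. Re (cnj P * (z \<omega>)\<^sup>2))"
    by (intro integrable_Re integrable_mult_right sq)
  have "expectation (\<lambda>\<omega>. Re (cnj P * (z \<omega>)\<^sup>2)) = Re (cnj P * P)"
    by (subst integral_Re) (use sq z' in simp_all)
  hence E_Re: "expectation (\<lambda>\<omega>. Re (cnj P * (z \<omega>)\<^sup>2)) = (cmod P)\<^sup>2"
    unfolding cmod_power2 by (simp add: power2_eq_square)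
  have ln_eq: "ln (improper_normal_density C P v) = - (C * (cmod v)\<^sup>2 - Re (cnj P * v\<^sup>2)) / D - ln pi - ln D / 2" for v
    using D unfolding improper_normal_density_def D_def[symmetric]
    by (simp add: ln_div ln_mult ln_sqrt del: times_complex.simps)
  show "integrable M (\<lambda>\<omega>. ln (improper_normal_density C P (z \<omega>)))"
    unfolding ln_eq using z' int_Re by (simp del: times_complex.simps)
  have "expectation (\<lambda>\<omega>. ln (improper_normal_density C P (z \<omega>))) = - (C * C - (cmod P)\<^sup>2) / D - ln pi - ln D / 2"
    unfolding ln_eq using z' int_Re by (simp add: E_Re prob_space del: times_complex.simps)
  also have "C * C - (cmod P)\<^sup>2 = D" by (simp add: D_def power2_eq_square)
  finally show "expectation (\<lambda>\<omega>. ln (improper_normal_density C P (z \<omega>))) = - 1 - ln pi - ln (C\<^sup>2 - (cmod P)\<^sup>2) / 2"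
    using D by (simp add: D_def[symmetric])
qed

section \<open>Independence of a signal from interference plus noise\<close>

lemma indep_set_commute: "indep_set A B \<Longrightarrow> indep_set B A"
  unfolding indep_sets2_eq by (metis Int_commute mult.commute)

lemma indep_var_commute: "indep_var S X T Y \<Longrightarrow> indep_var T Y S X"
  unfolding indep_var_eq by (blast intro: indep_set_commute)

text \<open>The two hypotheses make the law of the triple a product of three marginals, so
  \<open>X\<close> is independent of every function of the other two. It is applied with
  \<open>X\<close> the desired signal, \<open>Y\<close> the interfering one and \<open>Z\<close> the
  noise.\<close>

lemma indep_var_combine_right:
  assumes XY: "indep_var S X T Y" and XYZ: "indep_var (S \<Otimes>\<^sub>M T) (\<lambda>\<omega>. (X \<omega>, Y \<omega>)) U Z"
    and f: "f \<in> measurable (T \<Otimes>\<^sub>M U) S"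
  shows "indep_var S X S (\<lambda>\<omega>. f (Y \<omega>, Z \<omega>))"
proof -
  note XY' = XY[unfolded indep_var_distribution_eq]
  note XYZ' = XYZ[unfolded indep_var_distribution_eq]
  have [measurable]: "random_variable S X" "random_variable T Y" "random_variable U Z"
    using XY' XYZ' by auto
  note [measurable] = f
  define F where "F \<omega> = f (Y \<omega>, Z \<omega>)" for \<omega>
  have F [measurable]: "random_variable S F"
    unfolding F_def[abs_def] by measurable
  interpret PX: prob_space "distr M S X" by (rule prob_space_distr) simp
  interpret PY: prob_space "distr M T Y" by (rule prob_space_distr) simp
  interpret PZ: prob_space "distr M U Z" by (rule prob_space_distr) simp
  interpret PF: prob_space "distr M S F" by (rule prob_space_distr) simp
  have key: "emeasure M ((\<lambda>\<omega>. (X \<omega>, F \<omega>)) -` (A \<times> B) \<inter> space M) =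
      emeasure (distr M S X) A * (\<integral>\<^sup>+ y. \<integral>\<^sup>+ z. indicator B (f (y, z)) \<partial>distr M U Z \<partial>distr M T Y)"
    if A [measurable]: "A \<in> sets S" and B [measurable]: "B \<in> sets S" for A B
  proof -
    have "emeasure M ((\<lambda>\<omega>. (X \<omega>, F \<omega>)) -` (A \<times> B) \<inter> space M) =
        (\<integral>\<^sup>+ \<omega>. indicator ((\<lambda>\<omega>. (X \<omega>, F \<omega>)) -` (A \<times> B) \<inter> space M) \<omega> \<partial>M)"
      by simp
    also have "\<dots> = (\<integral>\<^sup>+ \<omega>. indicator A (X \<omega>) * indicator B (f (Y \<omega>, Z \<omega>)) \<partial>M)"
      by (rule nn_integral_cong) (auto simp: indicator_def F_def)
    also have "\<dots> = (\<integral>\<^sup>+ q. indicator A (fst (fst q)) * indicator B (f (snd (fst q), snd q))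
        \<partial>distr M ((S \<Otimes>\<^sub>M T) \<Otimes>\<^sub>M U) (\<lambda>\<omega>. ((X \<omega>, Y \<omega>), Z \<omega>)))"
      by (subst nn_integral_distr) simp_all
    also have "\<dots> = (\<integral>\<^sup>+ q. indicator A (fst (fst q)) * indicator B (f (snd (fst q), snd q))
        \<partial>((distr M S X \<Otimes>\<^sub>M distr M T Y) \<Otimes>\<^sub>M distr M U Z))"
      using XY' XYZ' by simp
    also have "\<dots> = (\<integral>\<^sup>+ x. \<integral>\<^sup>+ y. \<integral>\<^sup>+ z. indicator A x * indicator B (f (y, z)) \<partial>distr M U Z \<partial>distr M T Y \<partial>distr M S X)"
      by (simp add: PZ.nn_integral_fst[symmetric] PY.nn_integral_fst[symmetric])
    also have "\<dots> = (\<integral>\<^sup>+ x. indicator A x * (\<integral>\<^sup>+ y. \<integral>\<^sup>+ z. indicator B (f (y, z)) \<partial>distr M U Z \<partial>distr M T Y) \<partial>distr M S X)"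
      by (rule nn_integral_cong) (simp split: split_indicator)
    also have "\<dots> = emeasure (distr M S X) A * (\<integral>\<^sup>+ y. \<integral>\<^sup>+ z. indicator B (f (y, z)) \<partial>distr M U Z \<partial>distr M T Y)"
      by (simp add: nn_integral_multc)
    finally show ?thesis .
  qed
  \<comment> \<open>Taking \<open>A = space S\<close> in \<open>key\<close> identifies the iterated
    integral there with the law of \<open>F\<close>, and \<open>key\<close> becomes the product
    formula.\<close>
  have law_F: "emeasure (distr M S F) B = (\<integral>\<^sup>+ y. \<integral>\<^sup>+ z. indicator B (f (y, z)) \<partial>distr M U Z \<partial>distr M T Y)"
    if B [measurable]: "B \<in> sets S" for B
  proof -
    have "emeasure (distr M S F) B = emeasure M ((\<lambda>\<omega>. (X \<omega>, F \<omega>)) -` (space S \<times> B) \<inter> space M)"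
      using measurable_space[of X M S] by (subst emeasure_distr) (auto intro!: arg_cong[where f = "emeasure M"])
    thus ?thesis using key[OF sets.top B] PX.emeasure_space_1 by simp
  qed
  have "distr M S X \<Otimes>\<^sub>M distr M S F = distr M (S \<Otimes>\<^sub>M S) (\<lambda>\<omega>. (X \<omega>, F \<omega>))"
  proof (rule pair_measure_eqI)
    show "sigma_finite_measure (distr M S X)" "sigma_finite_measure (distr M S F)"
      by (rule PX.sigma_finite_measure_axioms PF.sigma_finite_measure_axioms)+
    show "sets (distr M S X \<Otimes>\<^sub>M distr M S F) = sets (distr M (S \<Otimes>\<^sub>M S) (\<lambda>\<omega>. (X \<omega>, F \<omega>)))"
      by (simp cong: sets_pair_measure_cong)
    fix A B assume "A \<in> sets (distr M S X)" "B \<in> sets (distr M S F)"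
    hence [measurable]: "A \<in> sets S" "B \<in> sets S" by auto
    show "emeasure (distr M S X) A * emeasure (distr M S F) B = emeasure (distr M (S \<Otimes>\<^sub>M S) (\<lambda>\<omega>. (X \<omega>, F \<omega>))) (A \<times> B)"
      by (subst (3) emeasure_distr) (simp_all add: key law_F)
  qed
  hence "indep_var S X S F" by (simp add: indep_var_distribution_eq)
  thus ?thesis by (simp add: F_def[abs_def])
qed

section \<open>Mutual information across additive noise\<close>

lemma mutual_information_additive_noise:
  fixes x s :: "'a \<Rightarrow> complex" and h :: complex
  assumes indep: "indep_var borel x borel s"
    and s: "distributed M lborel s (\<lambda>v. ennreal (g v))" and g_pos: "\<And>v. g v > 0"
    and y: "distributed M lborel (\<lambda>\<omega>. h * x \<omega> + s \<omega>) (\<lambda>v. ennreal (p v))" and p_pos: "\<And>v. p v > 0"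
    and int_g: "integrable M (\<lambda>\<omega>. ln (g (s \<omega>)))" and int_p: "integrable M (\<lambda>\<omega>. ln (p (h * x \<omega> + s \<omega>)))"
  shows "mutual_information (exp 1) borel borel x (\<lambda>\<omega>. h * x \<omega> + s \<omega>) =
    expectation (\<lambda>\<omega>. ln (g (s \<omega>))) - expectation (\<lambda>\<omega>. ln (p (h * x \<omega> + s \<omega>)))"
proof -
  define y where "y \<omega> = h * x \<omega> + s \<omega>" for \<omega>
  note y' = y[folded y_def]
  have [measurable]: "random_variable borel x" "random_variable borel s"
    using indep by (auto simp: indep_var_distribution_eq)
  have [measurable]: "random_variable borel y" by (simp add: y_def[abs_def])
  have g [measurable]: "g \<in> borel_measurable borel" and p [measurable]: "p \<in> borel_measurable borel"
    using distributed_real_measurable[OF _ s] distributed_real_measurable[OF _ y'] g_pos p_pos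
    by (auto simp: less_imp_le)
  define Px where "Px = distr M borel x"
  define Py where "Py = distr M borel y"
  define Ps where "Ps = distr M borel s"
  interpret Px: prob_space Px unfolding Px_def by (rule prob_space_distr) simp
  interpret Py: prob_space Py unfolding Py_def by (rule prob_space_distr) simp
  interpret Ps: prob_space Ps unfolding Ps_def by (rule prob_space_distr) simp
  have [simp, measurable_cong]: "sets Px = sets borel" "sets Py = sets borel" "sets Ps = sets borel"
    by (simp_all add: Px_def Py_def Ps_def)
  interpret Q: pair_prob_space Px Py ..
  have Py_eq: "Py = density lborel p"
    using distributed_distr_eq_density[OF y'] by (simp add: Py_def cong: distr_cong)
  have Ps_eq: "Ps = density lborel g"
    using distributed_distr_eq_density[OF s] by (simp add: Ps_def cong: distr_cong)
  \<comment> \<open>The conditional density of \<open>y\<close> given \<open>x\<close>, divided by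
    the density of \<open>y\<close>.\<close>
  define f where "f v = g (snd v - h * fst v) / p (snd v)" for v
  have f [measurable]: "f \<in> borel_measurable (borel \<Otimes>\<^sub>M borel)"
    unfolding f_def[abs_def] by measurable
  have f_pos: "f v > 0" for v using g_pos p_pos by (simp add: f_def)
  have joint: "distr M (borel \<Otimes>\<^sub>M borel) (\<lambda>\<omega>. (x \<omega>, y \<omega>)) = density (Px \<Otimes>\<^sub>M Py) (\<lambda>v. ennreal (f v))"
  proof (rule measure_eqI)
    show "sets (distr M (borel \<Otimes>\<^sub>M borel) (\<lambda>\<omega>. (x \<omega>, y \<omega>))) = sets (density (Px \<Otimes>\<^sub>M Py) (\<lambda>v. ennreal (f v)))"
      by (simp cong: sets_pair_measure_cong)
    fix A assume "A \<in> sets (distr M (borel \<Otimes>\<^sub>M borel) (\<lambda>\<omega>. (x \<omega>, y \<omega>)))"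
    hence A [measurable]: "A \<in> sets (borel \<Otimes>\<^sub>M borel)" by simp
    have "emeasure (distr M (borel \<Otimes>\<^sub>M borel) (\<lambda>\<omega>. (x \<omega>, y \<omega>))) A = (\<integral>\<^sup>+ \<omega>. indicator A (x \<omega>, y \<omega>) \<partial>M)"
      by (subst nn_integral_distr[where M' = "borel \<Otimes>\<^sub>M borel" and f = "indicator A", symmetric]) auto
    also have "\<dots> = (\<integral>\<^sup>+ v. indicator A (fst v, h * fst v + snd v) \<partial>distr M (borel \<Otimes>\<^sub>M borel) (\<lambda>\<omega>. (x \<omega>, s \<omega>)))"
      by (subst nn_integral_distr) (auto simp: y_def)
    also have "\<dots> = (\<integral>\<^sup>+ v. indicator A (fst v, h * fst v + snd v) \<partial>(Px \<Otimes>\<^sub>M Ps))"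
      using indep by (simp add: indep_var_distribution_eq Px_def Ps_def)
    also have "\<dots> = (\<integral>\<^sup>+ u. \<integral>\<^sup>+ v. indicator A (u, h * u + v) \<partial>Ps \<partial>Px)"
      by (subst Ps.nn_integral_fst[symmetric]) auto
    also have "\<dots> = (\<integral>\<^sup>+ u. \<integral>\<^sup>+ w. ennreal (f (u, w)) * indicator A (u, w) \<partial>Py \<partial>Px)"
    proof (rule nn_integral_cong)
      fix u
      \<comment> \<open>Given the input \<open>u\<close>, the output is the noise translated by
        \<open>h * u\<close>; dividing by the positive \<open>p\<close> then turns Lebesgue measure
        into the output law \<open>Py\<close>.\<close>
      have "(\<integral>\<^sup>+ v. indicator A (u, h * u + v) \<partial>Ps) = (\<integral>\<^sup>+ v. ennreal (g ((h * u + v) - h * u)) * indicator A (u, h * u + v) \<partial>lborel)"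
        unfolding Ps_eq by (subst nn_integral_density) auto
      also have "\<dots> = (\<integral>\<^sup>+ w. ennreal (g (w - h * u)) * indicator A (u, w) \<partial>lborel)"
        by (rule nn_integral_lborel_shift[where f = "\<lambda>w. ennreal (g (w - h * u)) * indicator A (u, w)"]) measurable
      also have "\<dots> = (\<integral>\<^sup>+ w. ennreal (p w) * (ennreal (f (u, w)) * indicator A (u, w)) \<partial>lborel)"
      proof (rule nn_integral_cong)
        fix w
        have "g (w - h * u) = p w * f (u, w)" using p_pos[of w] by (simp add: f_def)
        thus "ennreal (g (w - h * u)) * indicator A (u, w) = ennreal (p w) * (ennreal (f (u, w)) * indicator A (u, w))"
          using p_pos[of w] f_pos[of "(u, w)"] by (simp add: ennreal_mult less_imp_le mult.assoc)
      qed
      also have "\<dots> = (\<integral>\<^sup>+ w. ennreal (f (u, w)) * indicator A (u, w) \<partial>Py)"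
        unfolding Py_eq by (subst nn_integral_density) auto
      finally show "(\<integral>\<^sup>+ v. indicator A (u, h * u + v) \<partial>Ps) = (\<integral>\<^sup>+ w. ennreal (f (u, w)) * indicator A (u, w) \<partial>Py)" .
    qed
    also have "\<dots> = (\<integral>\<^sup>+ v. ennreal (f v) * indicator A v \<partial>(Px \<Otimes>\<^sub>M Py))"
      by (subst Py.nn_integral_fst[symmetric]) auto
    also have "\<dots> = emeasure (density (Px \<Otimes>\<^sub>M Py) (\<lambda>v. ennreal (f v))) A"
      by (subst emeasure_density) auto
    finally show "emeasure (distr M (borel \<Otimes>\<^sub>M borel) (\<lambda>\<omega>. (x \<omega>, y \<omega>))) A = emeasure (density (Px \<Otimes>\<^sub>M Py) (\<lambda>v. ennreal (f v))) A" .
  qed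
  have "mutual_information (exp 1) borel borel x y =
      KL_divergence (exp 1) (Px \<Otimes>\<^sub>M Py) (density (Px \<Otimes>\<^sub>M Py) (\<lambda>v. ennreal (f v)))"
    by (simp add: mutual_information_def joint Px_def[symmetric] Py_def[symmetric])
  also have "\<dots> = (\<integral>v. f v * ln (f v) \<partial>(Px \<Otimes>\<^sub>M Py))"
    by (subst Q.KL_density) (use f_pos in \<open>auto simp: less_imp_le log_ln[symmetric]\<close>)
  \<comment> \<open>The factor \<open>f v\<close> is absorbed into the joint law, so the divergence
    becomes an expectation over \<open>M\<close>, where f(x, y) = g(s) / p(y).\<close>
  also have "\<dots> = (\<integral>v. ln (f v) \<partial>density (Px \<Otimes>\<^sub>M Py) (\<lambda>v. ennreal (f v)))"
    by (subst integral_density) (use f_pos in \<open>auto simp: less_imp_le\<close>)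
  also have "\<dots> = expectation (\<lambda>\<omega>. ln (f (x \<omega>, y \<omega>)))"
    unfolding joint[symmetric] by (subst integral_distr) auto
  also have "\<dots> = expectation (\<lambda>\<omega>. ln (g (s \<omega>)) - ln (p (y \<omega>)))"
  proof (rule Bochner_Integration.integral_cong)
    fix \<omega>
    show "ln (f (x \<omega>, y \<omega>)) = ln (g (s \<omega>)) - ln (p (y \<omega>))"
      using g_pos[of "s \<omega>"] p_pos[of "y \<omega>"] by (simp add: f_def y_def ln_div)
  qed simp
  also have "\<dots> = expectation (\<lambda>\<omega>. ln (g (s \<omega>))) - expectation (\<lambda>\<omega>. ln (p (y \<omega>)))"
    using int_g int_p by (simp add: y_def)
  finally show ?thesis by (simp add: y_def[abs_def])
qed

section \<open>Constraints on the pseudo-covariance\<close>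

text \<open>Rotation by the angle pi/2 multiplies z^2 by -1 but preserves the law, so the
  pseudo-covariance equals its own negative.\<close>

lemma pseudo_covariance_circularly_symmetric:
  assumes "circularly_symmetric M z" and [measurable]: "random_variable borel z"
  shows "pseudo_covariance M z = 0"
proof -
  have "pseudo_covariance M z = (\<integral>v. v * v \<partial>distr M borel z)"
    unfolding pseudo_covariance_def by (subst integral_distr) auto
  also have "\<dots> = (\<integral>v. v * v \<partial>distr M borel (\<lambda>\<omega>. cis (pi / 2) * z \<omega>))"
    using assms(1)[unfolded circularly_symmetric_def, rule_format, of "pi / 2"] by (simp only:)
  also have "\<dots> = expectation (\<lambda>\<omega>. - (z \<omega> * z \<omega>))"
    by (subst integral_distr) (auto simp: cis_pi_half algebra_simps)
  also have "\<dots> = - pseudo_covariance M z" by (simp add: pseudo_covariance_def)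
  finally show ?thesis by simp
qed

text \<open>The modulus of E z^2 is at most E |z|^2.\<close>

lemma cmod_second_moment_le:
  assumes "gaussian_with_moments z C P"
  shows "cmod P \<le> C"
proof -
  have "cmod (expectation (\<lambda>\<omega>. (z \<omega>)\<^sup>2)) \<le> expectation (\<lambda>\<omega>. cmod ((z \<omega>)\<^sup>2))"
    by (rule integral_norm_bound)
  thus ?thesis using assms by (simp add: gaussian_with_moments_def norm_power)
qed

end

section \<open>The rate at one receiver and at both\<close>

text \<open>A single receiver with desired signal \<open>x\<close> and interferer \<open>x'\<close>.
  The variable \<open>N\<close> stands for the pair of noises and \<open>\<pi>\<close> picks the
  component seen by this receiver, so that both receivers are instances.\<close>

lemma achievable_rate_treating_interference_as_noise:
  fixes x x' n :: "'a \<Rightarrow> complex"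
    and h h' :: complex
  assumes "prob_space M"
    and x: "prob_space.gaussian_with_moments M x C P" and x': "prob_space.gaussian_with_moments M x' C' P'"
    and n: "prob_space.gaussian_with_moments M n (\<sigma>\<^sup>2) 0" and \<sigma>: "\<sigma>\<^sup>2 > 0"
    and indep: "prob_space.indep_var M borel x borel x'"
    and indep_noise: "prob_space.indep_var M (borel \<Otimes>\<^sub>M borel) (\<lambda>\<omega>. (x \<omega>, x' \<omega>)) (borel \<Otimes>\<^sub>M borel) N"
    and \<pi>: "\<pi> \<in> borel_measurable (borel \<Otimes>\<^sub>M borel)" and n_eq: "n = (\<lambda>\<omega>. \<pi> (N \<omega>))"
  defines "Cs \<equiv> (cmod h')\<^sup>2 * C' + \<sigma>\<^sup>2" and "Ps \<equiv> h'\<^sup>2 * P'"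
  defines "Cy \<equiv> (cmod h)\<^sup>2 * C + Cs" and "Py \<equiv> h\<^sup>2 * P + Ps"
  shows "achievable_rate M x (\<lambda>\<omega>. h * x \<omega> + (h' * x' \<omega> + n \<omega>)) =
    ln (1 + (cmod h)\<^sup>2 * C / (\<sigma>\<^sup>2 + (cmod h')\<^sup>2 * C')) +
    1 / 2 * ln ((1 - Cy powi (-2) * (cmod Py)\<^sup>2) / (1 - Cs powi (-2) * (cmod Ps)\<^sup>2))"
proof -
  interpret prob_space M by fact
  note [measurable] = \<pi>
  have [measurable]: "random_variable borel x" "random_variable borel x'"
    using x x' by (auto simp: gaussian_with_moments_def)
  have swap: "indep_var (borel \<Otimes>\<^sub>M borel) (\<lambda>\<omega>. (x' \<omega>, x \<omega>)) (borel \<Otimes>\<^sub>M borel) N"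
    using indep_var_compose[OF indep_noise, of "\<lambda>p. (snd p, fst p)" "borel \<Otimes>\<^sub>M borel" id "borel \<Otimes>\<^sub>M borel"]
    by (simp add: comp_def)
  have "indep_var borel (fst \<circ> (\<lambda>\<omega>. (x' \<omega>, x \<omega>))) borel (\<pi> \<circ> N)"
    by (rule indep_var_compose[OF swap]) auto
  hence ind_x'n: "indep_var borel (\<lambda>\<omega>. h' * x' \<omega>) borel n"
    using indep_var_compose[of borel x' borel n "\<lambda>v. h' * v" borel id borel] by (simp add: comp_def n_eq)
  have s: "gaussian_with_moments (\<lambda>\<omega>. h' * x' \<omega> + n \<omega>) Cs Ps"
    using gaussian_with_moments_add[OF gaussian_with_moments_mult[OF x'] n ind_x'n]
    by (simp add: Cs_def Ps_def)
  have ind_s: "indep_var borel x borel (\<lambda>\<omega>. h' * x' \<omega> + n \<omega>)"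
    using indep_var_combine_right[OF indep indep_noise, of "\<lambda>p. h' * fst p + \<pi> (snd p)"] by (simp add: n_eq)
  have ind_hx: "indep_var borel (\<lambda>\<omega>. h * x \<omega>) borel (\<lambda>\<omega>. h' * x' \<omega> + n \<omega>)"
    using indep_var_compose[OF ind_s, of "\<lambda>v. h * v" borel id borel] by (simp add: comp_def)
  have y: "gaussian_with_moments (\<lambda>\<omega>. h * x \<omega> + (h' * x' \<omega> + n \<omega>)) Cy Py"
    unfolding Cy_def Py_def by (rule gaussian_with_moments_add[OF gaussian_with_moments_mult[OF x] s ind_hx])
  have le: "cmod (h\<^sup>2 * P) \<le> (cmod h)\<^sup>2 * C" "cmod (h'\<^sup>2 * P') \<le> (cmod h')\<^sup>2 * C'"
    using cmod_second_moment_le[OF gaussian_with_moments_mult[OF x]]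
      cmod_second_moment_le[OF gaussian_with_moments_mult[OF x']] by auto
  \<comment> \<open>Positive noise variance makes the bound strict even for maximally improper
    signals; hence \<open>s\<close>, and by the triangle inequality also \<open>y\<close>, has a
    density.\<close>
  have PCs: "cmod Ps < Cs" using le \<sigma> unfolding Cs_def Ps_def by linarith
  have PCy: "cmod Py < Cy" using le PCs norm_triangle_ineq[of "h\<^sup>2 * P" Ps] by (simp add: Cy_def Py_def)
  have Cs: "Cs > 0" and Cy: "Cy > 0"
    using PCs PCy le_less_trans[OF norm_ge_zero] by blast+
  have Ds: "Cs\<^sup>2 - (cmod Ps)\<^sup>2 > 0" and Dy: "Cy\<^sup>2 - (cmod Py)\<^sup>2 > 0"
    using power_strict_mono[OF PCs norm_ge_zero, of 2] power_strict_mono[OF PCy norm_ge_zero, of 2] by auto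
  have "achievable_rate M x (\<lambda>\<omega>. h * x \<omega> + (h' * x' \<omega> + n \<omega>)) =
      (- 1 - ln pi - ln (Cs\<^sup>2 - (cmod Ps)\<^sup>2) / 2) - (- 1 - ln pi - ln (Cy\<^sup>2 - (cmod Py)\<^sup>2) / 2)"
    unfolding achievable_rate_def
    using mutual_information_additive_noise[OF ind_s distributed_improper_normal[OF s PCs] improper_normal_density_pos[OF PCs]
      distributed_improper_normal[OF y PCy] improper_normal_density_pos[OF PCy]
      expectation_ln_improper_normal_density(1)[OF s PCs] expectation_ln_improper_normal_density(1)[OF y PCy]]
    by (simp only: expectation_ln_improper_normal_density(2)[OF s PCs] expectation_ln_improper_normal_density(2)[OF y PCy])
  also have "\<dots> = ln (Cy\<^sup>2 - (cmod Py)\<^sup>2) / 2 - ln (Cs\<^sup>2 - (cmod Ps)\<^sup>2) / 2" by simp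
  \<comment> \<open>Factoring C^2 out of each C^2 - |P|^2 separates the rate of proper signals from
    the correction due to impropriety.\<close>
  also have "\<dots> = ln (Cy / Cs) + 1 / 2 * ln ((1 - Cy powi (-2) * (cmod Py)\<^sup>2) / (1 - Cs powi (-2) * (cmod Ps)\<^sup>2))"
  proof -
    have factor: "1 - c powi (-2) * (cmod p)\<^sup>2 = (c\<^sup>2 - (cmod p)\<^sup>2) / c\<^sup>2" if "c > 0" for c p
      using that by (simp add: power_int_def field_simps)
    have "ln (a / c) + 1 / 2 * ln ((A / a\<^sup>2) / (B / c\<^sup>2)) = ln A / 2 - ln B / 2"
      if "a > 0" "c > 0" "A > 0" "B > 0" for a c A B :: real
      using that by (simp add: ln_div ln_mult ln_realpow add_divide_distrib diff_divide_distrib)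
    from this[OF Cy Cs Dy Ds] show ?thesis
      unfolding factor[OF Cy] factor[OF Cs] ..
  qed
  also have "Cy / Cs = 1 + (cmod h)\<^sup>2 * C / (\<sigma>\<^sup>2 + (cmod h')\<^sup>2 * C')"
    using Cs by (simp add: Cy_def Cs_def field_simps)
  finally show ?thesis .
qed

theorem mainTheorem1:
  fixes M :: "'a measure"
    and h :: "nat \<Rightarrow> nat \<Rightarrow> complex"
    and x n :: "nat \<Rightarrow> 'a \<Rightarrow> complex"
    and \<sigma> :: real
    and C Cy Cs :: "nat \<Rightarrow> real"
    and Ct Cty Cts :: "nat \<Rightarrow> complex"
  assumes "prob_space M"
    and "\<sigma>\<^sup>2 > 0"
    and "\<forall>r\<in>{1,2}. complex_gaussian M (n r) \<and> zero_mean M (n r) \<and>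
           circularly_symmetric M (n r) \<and> covariance M (n r) = \<sigma>\<^sup>2"
    and "\<forall>r\<in>{1,2}. complex_gaussian M (x r) \<and> zero_mean M (x r)"
    and "prob_space.indep_var M borel (x 1) borel (x 2)"
    and "prob_space.indep_var M (borel \<Otimes>\<^sub>M borel) (\<lambda>\<omega>. (x 1 \<omega>, x 2 \<omega>))
           (borel \<Otimes>\<^sub>M borel) (\<lambda>\<omega>. (n 1 \<omega>, n 2 \<omega>))"
    and "\<forall>r\<in>{1,2}. C r = covariance M (x r) \<and> Ct r = pseudo_covariance M (x r)"
    and "\<forall>r\<in>{1,2}. Cy r = (cmod (h r 1))\<^sup>2 * C 1 + (cmod (h r 2))\<^sup>2 * C 2 + \<sigma>\<^sup>2"
    and "\<forall>r\<in>{1,2}. Cty r = (h r 1)\<^sup>2 * Ct 1 + (h r 2)\<^sup>2 * Ct 2"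
    and "\<forall>r\<in>{1,2}. Cs r = (cmod (h r (other_user r)))\<^sup>2 * C (other_user r) + \<sigma>\<^sup>2"
    and "\<forall>r\<in>{1,2}. Cts r = (h r (other_user r))\<^sup>2 * Ct (other_user r)"
  shows "\<forall>r\<in>{1,2}. cmod (Ct r) \<le> C r \<and>
    achievable_rate M (x r) (channel_output h x n r) =
      ln (1 + (cmod (h r r))\<^sup>2 * C r /
                (\<sigma>\<^sup>2 + (cmod (h r (other_user r)))\<^sup>2 * C (other_user r)))
      + 1 / 2 * ln ((1 - Cy r powi (-2) * (cmod (Cty r))\<^sup>2) /
                    (1 - Cs r powi (-2) * (cmod (Cts r))\<^sup>2))"
proof -
  interpret prob_space M by fact
  have x: "gaussian_with_moments (x r) (C r) (Ct r)" if "r \<in> {1, 2}" for r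
    using assms(4,7) that gaussian_with_moments_of_complex_gaussian by metis
  have n: "gaussian_with_moments (n r) (\<sigma>\<^sup>2) 0" if "r \<in> {1, 2}" for r
  proof -
    have "random_variable borel (n r)" using assms(3) that by (auto simp: zero_mean_def)
    thus ?thesis using assms(3) that gaussian_with_moments_of_complex_gaussian pseudo_covariance_circularly_symmetric by metis
  qed
  have [measurable]: "random_variable borel (x 1)" "random_variable borel (x 2)"
    using x[of 1] x[of 2] by (auto simp: gaussian_with_moments_def)
  \<comment> \<open>At receiver 2 the roles of desired signal and interferer are exchanged, so both
    independence hypotheses are needed with \<open>x 1\<close> and \<open>x 2\<close>
    swapped.\<close>
  have indep': "indep_var borel (x 2) borel (x 1)" by (rule indep_var_commute[OF assms(5)])
  have indep_noise': "indep_var (borel \<Otimes>\<^sub>M borel) (\<lambda>\<omega>. (x 2 \<omega>, x 1 \<omega>)) (borel \<Otimes>\<^sub>M borel) (\<lambda>\<omega>. (n 1 \<omega>, n 2 \<omega>))"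
    using indep_var_compose[OF assms(6), of "\<lambda>p. (snd p, fst p)" "borel \<Otimes>\<^sub>M borel" id "borel \<Otimes>\<^sub>M borel"]
    by (simp add: comp_def)
  have "achievable_rate M (x 1) (channel_output h x n 1) =
      ln (1 + (cmod (h 1 1))\<^sup>2 * C 1 / (\<sigma>\<^sup>2 + (cmod (h 1 2))\<^sup>2 * C 2))
      + 1 / 2 * ln ((1 - Cy 1 powi (-2) * (cmod (Cty 1))\<^sup>2) / (1 - Cs 1 powi (-2) * (cmod (Cts 1))\<^sup>2))"
    using achievable_rate_treating_interference_as_noise[OF assms(1) x[of 1] x[of 2] n[of 1] assms(2,5,6), where \<pi> = fst and h = "h 1 1" and h' = "h 1 2"]
      assms(8-11)
    by (simp add: channel_output_def[abs_def] other_user_def add_ac)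
  moreover have "achievable_rate M (x 2) (channel_output h x n 2) =
      ln (1 + (cmod (h 2 2))\<^sup>2 * C 2 / (\<sigma>\<^sup>2 + (cmod (h 2 1))\<^sup>2 * C 1))
      + 1 / 2 * ln ((1 - Cy 2 powi (-2) * (cmod (Cty 2))\<^sup>2) / (1 - Cs 2 powi (-2) * (cmod (Cts 2))\<^sup>2))"
    using achievable_rate_treating_interference_as_noise[OF assms(1) x[of 2] x[of 1] n[of 2] assms(2) indep' indep_noise', where \<pi> = snd and h = "h 2 2" and h' = "h 2 1"]
      assms(8-11)
    by (simp add: channel_output_def[abs_def] other_user_def add_ac)
  ultimately show ?thesis
    using cmod_second_moment_le[OF x[of 1]] cmod_second_moment_le[OF x[of 2]]
    by (simp add: other_user_def)
qed

end
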